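(* Let $T>0$, $p\ge2$ and $\frac14<\alpha\le\beta<\frac12$. Then $\chi^p_\alpha\hookrightarrow\chi^p_\beta$; that is, there exists a constant $C$ such that for every adapted, jointly measurable and $L^2(\Omega)$-continuous process $Y=\{Y(t,x),(t,x)\in[0,T]\times\mathbb{R}\}$, $$\|Y\|_{\chi^p_\beta}\le C\|Y\|_{\chi^p_\alpha}.$$ Moreover, the following stronger property holds for the Gagliardo-type seminorm: $$\sup_{\beta\in[\alpha,\frac12)}\|Y\|_{\chi^p_{\beta,2}}\le\tilde C\,\|Y\|_{\chi^p_\alpha},$$ where the constant $\tilde C$ depends only on $p$ and $T$.
   Context: Fix $T>0$ and a complete filtered probability space. $G$ is the fundamental solution on $\mathbb{R}$ of either the wave equation, $G_t(x)=\frac12 1_{\{|x|<t\}}$, or the heat equation, $G_t(x)=(2\pi t)^{-1/2}e^{-x^2/(2t)}$; the result is for either choice. For $H\in(\frac14,\frac12)$ let $\tilde c_H=\frac{H(1-2H)}2$. For $p\ge2$, $\chi^p_H$ is the space of $L^2(\Omega)$-continuous, adapted and jointly measurable processes $Y$ on $[0,T]\times\mathbb{R}$ with $$\|Y\|_{\chi^p_H}:=\|Y\|_{\chi^p_1}+\|Y\|_{\chi^p_{H,2}}<\infty,\qquad \|Y\|_{\chi^p_1}:=\sup_{(t,x)\in[0,T]\times\mathbb{R}}\mathbb{E}[|Y(t,x)|^p]^{1/p},$$ $$\|Y\|_{\chi^p_{H,2}}:=\sup_{(t,x)\in[0,T]\times\mathbb{R}}\Big(\tilde c_H\int_0^t\int_{\mathbb{R}^2}G^2_{t-s}(x-y)\frac{\big(\mathbb{E}[|Y(s,y)-Y(s,z)|^p]\big)^{2/p}}{|y-z|^{2-2H}}\,dy\,dz\,ds\Big)^{1/2}.$$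 *)

theory Defs
  imports "HOL-Probability.Probability"
begin

text \<open>
  All expectations, integrals and norms below take values in \<open>[0, \<infinity>]\<close>, so that they make sense for
  every measurable process and the inequalities also cover processes of infinite norm.
\<close>

text \<open>Powers on \<open>[0, \<infinity>]\<close>; only used with exponent \<open>a > 0\<close>, where \<open>\<infinity> powr a = \<infinity>\<close>.\<close>

definition ennreal_powr :: "ennreal \<Rightarrow> real \<Rightarrow> ennreal" where
  "ennreal_powr x a = (if x = \<infinity> then \<infinity> else ennreal (enn2real x powr a))"

definition wave_kernel :: "real \<Rightarrow> real \<Rightarrow> real" where
  "wave_kernel t x = 1 / 2 * indicator {x. \<bar>x\<bar> < t} x"

definition heat_kernel :: "real \<Rightarrow> real \<Rightarrow> real" where
  "heat_kernel t x = (2 * pi * t) powr (- 1 / 2) * exp (- x\<^sup>2 / (2 * t))"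

text \<open>
  The filtration is indexed by \<open>[0, T]\<close>; the values of \<open>F\<close> outside this interval are irrelevant.
  (The library locale \<open>filtration\<close> would index it by the whole type \<open>real\<close>.)
\<close>

locale complete_filtered_prob_space = prob_space M + complete_measure M for M :: "'a measure" +
  fixes T :: real and F :: "real \<Rightarrow> 'a measure"
  assumes subalgebra_F: "\<And>t. t \<in> {0..T} \<Longrightarrow> subalgebra M (F t)"
    and F_mono: "\<And>s t. 0 \<le> s \<Longrightarrow> s \<le> t \<Longrightarrow> t \<le> T \<Longrightarrow> subalgebra (F t) (F s)"
    and null_sets_F: "null_sets M \<subseteq> sets (F 0)"

text \<open>A process on \<open>[0, T] \<times> \<real>\<close> is a function \<open>Y t x \<omega>\<close> whose values for \<open>t \<notin> [0, T]\<close> are irrelevant.\<close>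

definition adapted_process ::
    "real \<Rightarrow> (real \<Rightarrow> 'a measure) \<Rightarrow> (real \<Rightarrow> real \<Rightarrow> 'a \<Rightarrow> real) \<Rightarrow> bool" where
  "adapted_process T F Y \<longleftrightarrow> (\<forall>t\<in>{0..T}. \<forall>x. Y t x \<in> borel_measurable (F t))"

definition jointly_measurable ::
    "'a measure \<Rightarrow> real \<Rightarrow> (real \<Rightarrow> real \<Rightarrow> 'a \<Rightarrow> real) \<Rightarrow> bool" where
  "jointly_measurable M T Y \<longleftrightarrow>
     (\<lambda>((t, x), \<omega>). Y t x \<omega>)
       \<in> borel_measurable ((restrict_space borel {0..T} \<Otimes>\<^sub>M borel) \<Otimes>\<^sub>M M)"

definition L2_continuous ::
    "'a measure \<Rightarrow> real \<Rightarrow> (real \<Rightarrow> real \<Rightarrow> 'a \<Rightarrow> real) \<Rightarrow> bool" where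
  "L2_continuous M T Y \<longleftrightarrow>
     (\<forall>t\<in>{0..T}. \<forall>x.
        Y t x \<in> borel_measurable M \<and>
        (\<integral>\<^sup>+ \<omega>. ennreal ((Y t x \<omega>)\<^sup>2) \<partial>M) < \<infinity> \<and>
        ((\<lambda>(s, y). \<integral>\<^sup>+ \<omega>. ennreal ((Y s y \<omega> - Y t x \<omega>)\<^sup>2) \<partial>M) \<longlongrightarrow> 0)
          (at (t, x) within {0..T} \<times> UNIV))"

definition regular_process ::
    "'a measure \<Rightarrow> (real \<Rightarrow> 'a measure) \<Rightarrow> real \<Rightarrow> (real \<Rightarrow> real \<Rightarrow> 'a \<Rightarrow> real) \<Rightarrow> bool" where
  "regular_process M F T Y \<longleftrightarrow>
     adapted_process T F Y \<and> jointly_measurable M T Y \<and> L2_continuous M T Y"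

definition abs_moment :: "'a measure \<Rightarrow> real \<Rightarrow> ('a \<Rightarrow> real) \<Rightarrow> ennreal" where
  "abs_moment M p X = (\<integral>\<^sup>+ \<omega>. ennreal (\<bar>X \<omega>\<bar> powr p) \<partial>M)"

definition c_tilde :: "real \<Rightarrow> real" where
  "c_tilde H = H * (1 - 2 * H) / 2"

definition chi1_norm ::
    "'a measure \<Rightarrow> real \<Rightarrow> real \<Rightarrow> (real \<Rightarrow> real \<Rightarrow> 'a \<Rightarrow> real) \<Rightarrow> ennreal" where
  "chi1_norm M T p Y = (SUP (t, x) \<in> {0..T} \<times> UNIV. ennreal_powr (abs_moment M p (Y t x)) (1 / p))"

text \<open>On the diagonal \<open>y = z\<close> the integrand is \<open>0 / 0 = 0\<close> in \<^typ>\<open>ennreal\<close>.\<close>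

definition chi2_seminorm ::
    "'a measure \<Rightarrow> (real \<Rightarrow> real \<Rightarrow> real) \<Rightarrow> real \<Rightarrow> real \<Rightarrow> real \<Rightarrow>
     (real \<Rightarrow> real \<Rightarrow> 'a \<Rightarrow> real) \<Rightarrow> ennreal" where
  "chi2_seminorm M G T p H Y =
     (SUP (t, x) \<in> {0..T} \<times> UNIV.
        ennreal_powr
          (ennreal (c_tilde H) *
           (\<integral>\<^sup>+ s \<in> {0..t}.
              (\<integral>\<^sup>+ (y, z).
                 ennreal ((G (t - s) (x - y))\<^sup>2) *
                 ennreal_powr (abs_moment M p (\<lambda>\<omega>. Y s y \<omega> - Y s z \<omega>)) (2 / p) /
                 ennreal (\<bar>y - z\<bar> powr (2 - 2 * H))
               \<partial>(lborel :: (real \<times> real) measure))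
            \<partial>lborel))
          (1 / 2))"

definition chi_norm ::
    "'a measure \<Rightarrow> (real \<Rightarrow> real \<Rightarrow> real) \<Rightarrow> real \<Rightarrow> real \<Rightarrow> real \<Rightarrow>
     (real \<Rightarrow> real \<Rightarrow> 'a \<Rightarrow> real) \<Rightarrow> ennreal" where
  "chi_norm M G T p H Y = chi1_norm M T p Y + chi2_seminorm M G T p H Y"

definition chi_space ::
    "'a measure \<Rightarrow> (real \<Rightarrow> 'a measure) \<Rightarrow> (real \<Rightarrow> real \<Rightarrow> real) \<Rightarrow> real \<Rightarrow> real \<Rightarrow> real \<Rightarrow>
     (real \<Rightarrow> real \<Rightarrow> 'a \<Rightarrow> real) set" where
  "chi_space M F G T p H = {Y. regular_process M F T Y \<and> chi_norm M G T p H Y < \<infinity>}"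

end

theory Submission
  imports Defs
begin

text \<open>
  Everything rests on the bound of the seminorm of exponent \<open>\<beta>\<close> by the norm of exponent
  \<open>\<alpha> \<le> \<beta>\<close>, with a constant that involves neither exponent (\<open>chi2_seminorm_le\<close>). Split the
  Gagliardo integral according to the distance of \<open>y\<close> and \<open>z\<close> (\<open>gagliardo_integral_le\<close>).

  For \<open>\<bar>y - z\<bar> \<le> 1\<close> the weight \<open>\<bar>y - z\<bar> powr (2 * H - 2)\<close> decreases in \<open>H\<close>, and so does the
  prefactor \<open>c_tilde H\<close> on \<open>[1/4, 1/2]\<close>; the near pairs therefore contribute at most what they
  contribute to the seminorm of exponent \<open>\<alpha>\<close>.

  For \<open>\<bar>y - z\<bar> > 1\<close> the increments of \<open>Y\<close> are controlled by \<open>N = chi1_norm M T p Y\<close>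
  (\<open>increment_moment_le\<close>), the weight integrates in \<open>z\<close> to \<open>2 / (1 - 2 * \<beta>)\<close>, and what remains is
  the space-time integral of \<open>G\<^sup>2\<close>, which is finite for both kernels and bounded in terms of \<open>T\<close>
  (\<open>wave_kernel_energy_le\<close>, \<open>heat_kernel_energy_le\<close>). The weight integral blows up as \<open>\<beta>\<close> tends
  to \<open>1/2\<close>, but \<open>c_tilde \<beta>\<close> carries the compensating factor \<open>1 - 2 * \<beta>\<close>. With \<open>K\<close> a bound of the
  space-time integral, the far pairs contribute at most \<open>4 * K * N\<^sup>2\<close>, and subadditivity of the
  square root gives the constant \<open>1 + 2 * sqrt K\<close>.
\<close>

section \<open>Powers and integrals with values in the extended half-line\<close>

lemma ennreal_powr_ennreal: "x \<ge> 0 \<Longrightarrow> ennreal_powr (ennreal x) a = ennreal (x powr a)"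
  by (simp add: ennreal_powr_def)

lemma ennreal_powr_mono:
  assumes "0 \<le> a" "x \<le> y"
  shows "ennreal_powr x a \<le> ennreal_powr y a"
proof (cases "y = \<infinity>")
  case False
  then have "x \<noteq> \<infinity>"
    using assms(2) by (auto simp: top_unique)
  moreover have "enn2real x \<le> enn2real y"
    using assms(2) False by (intro enn2real_mono) (auto simp: less_top)
  ultimately show ?thesis
    using False assms(1) by (auto simp: ennreal_powr_def intro!: ennreal_leI powr_mono2)
qed (simp add: ennreal_powr_def)

lemma ennreal_powr_half_add_le:
  "ennreal_powr (x + y) (1/2) \<le> ennreal_powr x (1/2) + ennreal_powr y (1/2)"
proof (cases "x = \<infinity> \<or> y = \<infinity>")
  case False
  then obtain a where a: "x = ennreal a" "a \<ge> 0"
    by (cases x) auto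
  obtain b where b: "y = ennreal b" "b \<ge> 0"
    using False by (cases y) auto
  have "x + y = ennreal (a + b)"
    using a b by simp
  then have "ennreal_powr (x + y) (1/2) = ennreal (sqrt (a + b))"
    using a(2) b(2) by (simp add: ennreal_powr_ennreal powr_half_sqrt del: ennreal_plus)
  also have "\<dots> \<le> ennreal (sqrt a + sqrt b)"
    using a(2) b(2) by (intro ennreal_leI sqrt_add_le_add_sqrt)
  also have "\<dots> = ennreal_powr x (1/2) + ennreal_powr y (1/2)"
    using a b by (simp add: ennreal_powr_ennreal powr_half_sqrt)
  finally show ?thesis .
qed (auto simp: ennreal_powr_def)

text \<open>
  A simple function \<open>u \<le> f + g\<close> is at most \<open>v + g\<close> with \<open>v = u - g\<close>, and \<open>v\<close> is a measurable
  minorant of \<open>f\<close>. In the application \<open>f\<close> is built from the moments of the process and \<open>g\<close> is an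
  explicit function.
\<close>

lemma nn_integral_add_le:
  assumes g[measurable]: "g \<in> borel_measurable M"
  shows "(\<integral>\<^sup>+ x. f x + g x \<partial>M) \<le> (\<integral>\<^sup>+ x. f x \<partial>M) + (\<integral>\<^sup>+ x. g x \<partial>M)"
proof -
  have "integral\<^sup>S M u \<le> (\<integral>\<^sup>+ x. f x \<partial>M) + (\<integral>\<^sup>+ x. g x \<partial>M)"
    if u: "simple_function M u" "u \<le> (\<lambda>x. f x + g x)" for u
  proof -
    have [measurable]: "u \<in> borel_measurable M"
      using u(1) by (rule borel_measurable_simple_function)
    \<comment> \<open>Where \<open>g\<close> is infinite the difference would be infinite as well, since \<open>\<infinity> - \<infinity> = \<infinity>\<close>.\<close>
    define v where "v x = (if g x = \<infinity> then 0 else u x - g x)" for x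
    have [measurable]: "v \<in> borel_measurable M"
      unfolding v_def by measurable
    have "v x \<le> f x" for x
      using le_funD[OF u(2), of x] by (auto simp: v_def ennreal_minus_le_iff add.commute)
    moreover have "u x \<le> v x + g x" for x
      by (cases "g x \<le> u x") (auto simp: v_def diff_add_cancel_ennreal intro: add_increasing)
    ultimately have "integral\<^sup>N M u \<le> (\<integral>\<^sup>+ x. v x + g x \<partial>M)"
      and v: "(\<integral>\<^sup>+ x. v x \<partial>M) \<le> (\<integral>\<^sup>+ x. f x \<partial>M)"
      by (auto intro!: nn_integral_mono)
    then have "integral\<^sup>S M u \<le> (\<integral>\<^sup>+ x. v x \<partial>M) + (\<integral>\<^sup>+ x. g x \<partial>M)"
      using u(1) by (simp add: nn_integral_add nn_integral_eq_simple_integral)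
    also have "\<dots> \<le> (\<integral>\<^sup>+ x. f x \<partial>M) + (\<integral>\<^sup>+ x. g x \<partial>M)"
      using v by (rule add_right_mono)
    finally show ?thesis .
  qed
  then show ?thesis
    unfolding nn_integral_def[of M "\<lambda>x. f x + g x"] by (intro SUP_least) simp
qed

lemma ennreal_divide_antimono:
  fixes a b c :: ennreal
  assumes "b \<le> c"
  shows "a / c \<le> a / b"
proof -
  have "inverse c \<le> inverse b"
    including ennreal.lifting
    using assms by transfer (auto intro: ereal_inverse_antimono)
  then show ?thesis
    unfolding divide_ennreal_def by (rule mult_left_mono) simp
qed

lemma nn_integral_far_powr_le:
  fixes a y :: real
  assumes "a < -1"
  shows "(\<integral>\<^sup>+ z. ennreal (if 1 < \<bar>y - z\<bar> then \<bar>y - z\<bar> powr a else 0) \<partial>lborel) \<le> ennreal (2 / (- a - 1))"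
proof -
  define h :: "real \<Rightarrow> ennreal" where "h w = ennreal (if 1 \<le> w then w powr a else 0)" for w
  have [measurable]: "h \<in> borel_measurable borel"
    unfolding h_def by measurable
  have "- (1 powr (a + 1)) / (a + 1) = 1 / (- a - 1)"
    using assms by (simp add: divide_simps)
  then have "((\<lambda>w. if w \<in> {1..} then w powr a else 0) has_integral (1 / (- a - 1))) UNIV"
    using has_integral_powr_to_inf[of a 1] assms by (simp add: has_integral_restrict_UNIV del: atLeast_iff)
  then have h: "integral\<^sup>N lborel h = ennreal (1 / (- a - 1))"
    unfolding h_def by (intro nn_integral_has_integral_lborel) (auto simp only: atLeast_iff, auto)
  have reflect: "(\<integral>\<^sup>+ z. h (y - z) \<partial>lborel) = integral\<^sup>N lborel h"
    using nn_integral_real_affine[of h "-1" y] by simp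
  have translate: "(\<integral>\<^sup>+ z. h (z - y) \<partial>lborel) = integral\<^sup>N lborel h"
    using nn_integral_real_affine[of h 1 "- y"] by simp
  have "(\<integral>\<^sup>+ z. ennreal (if 1 < \<bar>y - z\<bar> then \<bar>y - z\<bar> powr a else 0) \<partial>lborel)
      \<le> (\<integral>\<^sup>+ z. h (y - z) + h (z - y) \<partial>lborel)"
    by (intro nn_integral_mono) (auto simp: h_def abs_if)
  also have "\<dots> = ennreal (1 / (- a - 1)) + ennreal (1 / (- a - 1))"
    by (subst nn_integral_add) (simp_all only: reflect translate h, measurable)
  also have "\<dots> = ennreal (2 / (- a - 1))"
    using assms by (subst ennreal_plus[symmetric]) simp_all
  finally show ?thesis .
qed

section \<open>Changing the exponent in the Gagliardo integral\<close>

lemma far_pairs_integral_le: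
  fixes g :: "real \<Rightarrow> real"
  assumes g[measurable]: "g \<in> borel_measurable borel" and \<beta>: "\<beta> < 1/2" and B: "B \<ge> 0"
  shows "(\<integral>\<^sup>+ (y, z). ennreal ((g y)\<^sup>2) * (ennreal B *
            ennreal (if 1 < \<bar>y - z\<bar> then \<bar>y - z\<bar> powr (2 * \<beta> - 2) else 0)) \<partial>lborel)
         \<le> ennreal (2 * B / (1 - 2 * \<beta>)) * (\<integral>\<^sup>+ y. ennreal ((g y)\<^sup>2) \<partial>lborel)"
    (is "?L \<le> _")
proof -
  define \<tau> where "\<tau> y z = ennreal (if 1 < \<bar>y - z\<bar> then \<bar>y - z\<bar> powr (2 * \<beta> - 2) else 0)" for y z :: real
  have [measurable]: "(\<lambda>(y, z). \<tau> y z) \<in> borel_measurable (borel \<Otimes>\<^sub>M borel)"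
    unfolding \<tau>_def by measurable
  have [measurable]: "\<tau> y \<in> borel_measurable borel" for y
    unfolding \<tau>_def by measurable
  have "?L = (\<integral>\<^sup>+ y. \<integral>\<^sup>+ z. ennreal ((g y)\<^sup>2) * (ennreal B * \<tau> y z) \<partial>lborel \<partial>lborel)"
    unfolding lborel_prod[symmetric] \<tau>_def[symmetric]
    by (subst lborel.nn_integral_fst[symmetric]) (auto simp: case_prod_beta')
  also have "\<dots> = (\<integral>\<^sup>+ y. ennreal ((g y)\<^sup>2) * (ennreal B * (\<integral>\<^sup>+ z. \<tau> y z \<partial>lborel)) \<partial>lborel)"
    by (simp add: nn_integral_cmult)
  also have "\<dots> \<le> (\<integral>\<^sup>+ y. ennreal ((g y)\<^sup>2) * (ennreal B * ennreal (2 / (1 - 2 * \<beta>))) \<partial>lborel)"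
    using nn_integral_far_powr_le[of "2 * \<beta> - 2"] \<beta>
    by (intro nn_integral_mono mult_left_mono) (auto simp: \<tau>_def algebra_simps)
  also have "\<dots> = ennreal (2 * B / (1 - 2 * \<beta>)) * (\<integral>\<^sup>+ y. ennreal ((g y)\<^sup>2) \<partial>lborel)"
    using \<beta> B by (subst nn_integral_multc) (auto simp: ac_simps simp flip: ennreal_mult)
  finally show ?thesis .
qed

text \<open>
  At distance at most \<open>1\<close> a larger exponent \<open>H\<close> gives a smaller weight \<open>\<bar>y - z\<bar> powr (2 * H - 2)\<close>;
  at larger distance the weight is integrable in \<open>z\<close> and a bound for the increments suffices.
\<close>

lemma gagliardo_integral_le:
  fixes g :: "real \<Rightarrow> real" and D :: "real \<Rightarrow> real \<Rightarrow> ennreal"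
  assumes g[measurable]: "g \<in> borel_measurable borel"
    and \<alpha>\<beta>: "\<alpha> \<le> \<beta>" "\<beta> < 1/2" and B: "B \<ge> 0" and D: "\<And>y z. D y z \<le> ennreal B"
  shows "(\<integral>\<^sup>+ (y, z). ennreal ((g y)\<^sup>2) * D y z / ennreal (\<bar>y - z\<bar> powr (2 - 2 * \<beta>)) \<partial>lborel)
         \<le> (\<integral>\<^sup>+ (y, z). ennreal ((g y)\<^sup>2) * D y z / ennreal (\<bar>y - z\<bar> powr (2 - 2 * \<alpha>)) \<partial>lborel)
           + ennreal (2 * B / (1 - 2 * \<beta>)) * (\<integral>\<^sup>+ y. ennreal ((g y)\<^sup>2) \<partial>lborel)"
proof -
  define \<tau> where "\<tau> w = ennreal (if 1 < \<bar>w\<bar> then \<bar>w\<bar> powr (2 * \<beta> - 2) else 0)" for w :: real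
  have [measurable]: "\<tau> \<in> borel_measurable borel"
    unfolding \<tau>_def by measurable
  have weight: "D y z / ennreal (\<bar>w\<bar> powr (2 - 2 * \<beta>))
      \<le> D y z / ennreal (\<bar>w\<bar> powr (2 - 2 * \<alpha>)) + ennreal B * \<tau> w" for y z w
  proof (cases "1 < \<bar>w\<bar>")
    case True
    then have "D y z / ennreal (\<bar>w\<bar> powr (2 - 2 * \<beta>)) = D y z * \<tau> w"
      by (simp add: \<tau>_def divide_ennreal_def inverse_ennreal flip: powr_minus)
    then show ?thesis
      using D[of y z] by (simp add: add_increasing mult_right_mono)
  next
    case False
    then have "\<bar>w\<bar> powr (2 - 2 * \<alpha>) \<le> \<bar>w\<bar> powr (2 - 2 * \<beta>)"
      using \<alpha>\<beta> by (intro powr_mono') auto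
    then have "D y z / ennreal (\<bar>w\<bar> powr (2 - 2 * \<beta>)) \<le> D y z / ennreal (\<bar>w\<bar> powr (2 - 2 * \<alpha>))"
      by (intro ennreal_divide_antimono ennreal_leI)
    then show ?thesis
      by (simp add: add_increasing2)
  qed
  have "(\<integral>\<^sup>+ (y, z). ennreal ((g y)\<^sup>2) * D y z / ennreal (\<bar>y - z\<bar> powr (2 - 2 * \<beta>)) \<partial>lborel)
      \<le> (\<integral>\<^sup>+ q. (case q of (y, z) \<Rightarrow> ennreal ((g y)\<^sup>2) * D y z / ennreal (\<bar>y - z\<bar> powr (2 - 2 * \<alpha>)))
            + (case q of (y, z) \<Rightarrow> ennreal ((g y)\<^sup>2) * (ennreal B * \<tau> (y - z))) \<partial>lborel)"
  proof (rule nn_integral_mono, clarify)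
    fix y z
    show "ennreal ((g y)\<^sup>2) * D y z / ennreal (\<bar>y - z\<bar> powr (2 - 2 * \<beta>))
      \<le> ennreal ((g y)\<^sup>2) * D y z / ennreal (\<bar>y - z\<bar> powr (2 - 2 * \<alpha>))
        + ennreal ((g y)\<^sup>2) * (ennreal B * \<tau> (y - z))"
      using mult_left_mono[OF weight[of y z "y - z"], of "ennreal ((g y)\<^sup>2)"]
      by (simp add: ennreal_times_divide distrib_left)
  qed
  also have "\<dots> \<le> (\<integral>\<^sup>+ (y, z). ennreal ((g y)\<^sup>2) * D y z / ennreal (\<bar>y - z\<bar> powr (2 - 2 * \<alpha>)) \<partial>lborel)
      + (\<integral>\<^sup>+ (y, z). ennreal ((g y)\<^sup>2) * (ennreal B * \<tau> (y - z)) \<partial>lborel)"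
    by (rule nn_integral_add_le) (simp flip: borel_prod)
  also have "\<dots> \<le> (\<integral>\<^sup>+ (y, z). ennreal ((g y)\<^sup>2) * D y z / ennreal (\<bar>y - z\<bar> powr (2 - 2 * \<alpha>)) \<partial>lborel)
      + ennreal (2 * B / (1 - 2 * \<beta>)) * (\<integral>\<^sup>+ y. ennreal ((g y)\<^sup>2) \<partial>lborel)"
    using far_pairs_integral_le[OF g \<alpha>\<beta>(2) B] by (intro add_left_mono) (simp add: \<tau>_def)
  finally show ?thesis .
qed

section \<open>Moments of increments\<close>

lemma abs_diff_powr_le:
  fixes a b p :: real
  assumes "p \<ge> 0"
  shows "\<bar>a - b\<bar> powr p \<le> 2 powr p * (\<bar>a\<bar> powr p + \<bar>b\<bar> powr p)"
proof -
  have "\<bar>a - b\<bar> powr p \<le> (2 * max \<bar>a\<bar> \<bar>b\<bar>) powr p"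
    using assms by (intro powr_mono2) auto
  also have "\<dots> = 2 powr p * max \<bar>a\<bar> \<bar>b\<bar> powr p"
    by (simp add: powr_mult)
  also have "\<dots> \<le> 2 powr p * (\<bar>a\<bar> powr p + \<bar>b\<bar> powr p)"
    by (intro mult_left_mono) (auto simp: max_def)
  finally show ?thesis .
qed

lemma abs_moment_le_powr:
  assumes "p > 0" "N \<ge> 0" "ennreal_powr (abs_moment M p X) (1 / p) \<le> ennreal N"
  shows "abs_moment M p X \<le> ennreal (N powr p)"
proof (cases "abs_moment M p X")
  case (real r)
  then have "r powr (1 / p) \<le> N"
    using assms by (simp add: ennreal_powr_ennreal)
  then have "(r powr (1 / p)) powr p \<le> N powr p"
    using assms by (intro powr_mono2) auto
  then show ?thesis
    using real assms by (simp add: powr_powr ennreal_leI)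
qed (use assms in \<open>simp add: ennreal_powr_def top_unique\<close>)

text \<open>
  The elementary bound of \<open>\<bar>a - b\<bar> powr p\<close> above costs a factor \<open>2 powr (2 / p) \<le> 2\<close> against the
  constant \<open>4\<close> of Minkowski's inequality; the resulting \<open>8\<close> still does not depend on \<open>p\<close>.
\<close>

lemma increment_moment_le:
  assumes p: "p \<ge> 2" and N: "N \<ge> 0"
    and [measurable]: "X \<in> borel_measurable M" "Z \<in> borel_measurable M"
    and X: "ennreal_powr (abs_moment M p X) (1 / p) \<le> ennreal N"
    and Z: "ennreal_powr (abs_moment M p Z) (1 / p) \<le> ennreal N"
  shows "ennreal_powr (abs_moment M p (\<lambda>\<omega>. X \<omega> - Z \<omega>)) (2 / p) \<le> ennreal (8 * N\<^sup>2)"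
proof -
  have "abs_moment M p (\<lambda>\<omega>. X \<omega> - Z \<omega>)
      \<le> (\<integral>\<^sup>+ \<omega>. ennreal (2 powr p) * (ennreal (\<bar>X \<omega>\<bar> powr p) + ennreal (\<bar>Z \<omega>\<bar> powr p)) \<partial>M)"
    unfolding abs_moment_def using p
    by (intro nn_integral_mono)
       (auto intro!: ennreal_leI abs_diff_powr_le simp flip: ennreal_mult ennreal_plus)
  also have "\<dots> = ennreal (2 powr p) * (abs_moment M p X + abs_moment M p Z)"
    unfolding abs_moment_def by (simp add: nn_integral_cmult nn_integral_add)
  also have "\<dots> \<le> ennreal (2 powr p) * (ennreal (N powr p) + ennreal (N powr p))"
    using p N X Z by (intro mult_left_mono add_mono abs_moment_le_powr) auto
  also have "\<dots> = ennreal (2 * (2 * N) powr p)"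
    using N by (simp add: powr_mult flip: ennreal_mult ennreal_plus)
  finally have "ennreal_powr (abs_moment M p (\<lambda>\<omega>. X \<omega> - Z \<omega>)) (2 / p)
      \<le> ennreal_powr (ennreal (2 * (2 * N) powr p)) (2 / p)"
    using p by (intro ennreal_powr_mono) auto
  also have "\<dots> = ennreal (2 powr (2 / p) * (2 * N)\<^sup>2)"
    using p N by (simp add: ennreal_powr_ennreal powr_mult powr_powr)
  also have "\<dots> \<le> ennreal (2 powr 1 * (2 * N)\<^sup>2)"
    using p by (intro ennreal_leI mult_right_mono powr_mono) auto
  finally show ?thesis
    by (simp add: power_mult_distrib)
qed

section \<open>Energy of the wave and heat kernels\<close>

text \<open>
  A bound \<open>K\<close> for the integral of \<open>G\<^sup>2\<close> over \<open>[0, T] \<times> \<real>\<close>. The majorant \<open>k\<close> of the spatial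
  integral stands for an explicit power of time, whose measurability is immediate.
\<close>

definition kernel_energy_le :: "(real \<Rightarrow> real \<Rightarrow> real) \<Rightarrow> real \<Rightarrow> real \<Rightarrow> bool" where
  "kernel_energy_le G T K \<longleftrightarrow>
     (\<forall>r. G r \<in> borel_measurable borel) \<and>
     (\<exists>k \<in> borel_measurable borel.
        (\<forall>r\<ge>0. (\<integral>\<^sup>+ x. ennreal ((G r x)\<^sup>2) \<partial>lborel) \<le> k r) \<and>
        (\<integral>\<^sup>+ r \<in> {0..T}. k r \<partial>lborel) \<le> ennreal K)"

lemma nn_integral_powr_Icc:
  assumes "T \<ge> 0" "a > -1"
  shows "(\<integral>\<^sup>+ r \<in> {0..T}. ennreal (r powr a) \<partial>lborel) = ennreal (T powr (a + 1) / (a + 1))"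
proof -
  have "((\<lambda>r. if r \<in> {0..T} then r powr a else 0) has_integral (T powr (a + 1) / (a + 1))) UNIV"
    using has_integral_powr_from_0[OF assms(2,1)] by (simp only: has_integral_restrict_UNIV)
  then have "(\<integral>\<^sup>+ r. ennreal (if r \<in> {0..T} then r powr a else 0) \<partial>lborel)
      = ennreal (T powr (a + 1) / (a + 1))"
    by (rule nn_integral_has_integral_lborel[rotated 2]) auto
  moreover have "(\<integral>\<^sup>+ r \<in> {0..T}. ennreal (r powr a) \<partial>lborel)
      = (\<integral>\<^sup>+ r. ennreal (if r \<in> {0..T} then r powr a else 0) \<partial>lborel)"
    by (intro nn_integral_cong) (auto simp: indicator_def)
  ultimately show ?thesis
    by simp
qed

lemma wave_kernel_energy_le:
  assumes "T \<ge> 0"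
  shows "kernel_energy_le wave_kernel T (T\<^sup>2)"
proof -
  have "(\<integral>\<^sup>+ x. ennreal ((wave_kernel r x)\<^sup>2) \<partial>lborel) \<le> ennreal (r powr 1)" if "r \<ge> 0" for r
  proof -
    have "(\<integral>\<^sup>+ x. ennreal ((wave_kernel r x)\<^sup>2) \<partial>lborel)
        = (\<integral>\<^sup>+ x. ennreal (1 / 4) * indicator {- r<..<r} x \<partial>lborel)"
      by (intro nn_integral_cong)
         (auto simp: wave_kernel_def indicator_def power2_eq_square)
    also have "\<dots> = ennreal (1 / 4) * ennreal (2 * r)"
      using that by (simp add: nn_integral_cmult_indicator)
    also have "\<dots> \<le> ennreal (r powr 1)"
      using that by (simp add: ennreal_leI flip: ennreal_mult)
    finally show ?thesis .
  qed
  moreover have "(\<integral>\<^sup>+ r \<in> {0..T}. ennreal (r powr 1) \<partial>lborel) \<le> ennreal (T\<^sup>2)"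
    using assms by (subst nn_integral_powr_Icc) (auto intro!: ennreal_leI)
  moreover have "wave_kernel r \<in> borel_measurable borel" for r
    unfolding wave_kernel_def by measurable
  ultimately show ?thesis
    unfolding kernel_energy_le_def by (auto intro!: bexI[where x = "\<lambda>r. ennreal (r powr 1)"])
qed

text \<open>
  The square of the heat kernel at time \<open>r\<close> is \<open>1 / (2 * sqrt (pi * r))\<close> times the Gaussian density
  of variance \<open>r / 2\<close>.
\<close>

lemma heat_kernel_energy_le:
  assumes "T \<ge> 0"
  shows "kernel_energy_le heat_kernel T (2 * sqrt T)"
proof -
  have "(\<integral>\<^sup>+ x. ennreal ((heat_kernel r x)\<^sup>2) \<partial>lborel) \<le> ennreal (r powr (-1/2))" if "r \<ge> 0" for r
  proof (cases "r = 0")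
    case False
    with that have r: "r > 0" by simp
    have square: "(heat_kernel r x)\<^sup>2 = 1 / (2 * sqrt (pi * r)) * normal_density 0 (sqrt (r / 2)) x" for x
    proof -
      have "(exp (- x\<^sup>2 / (2 * r)))\<^sup>2 = exp (- x\<^sup>2 / r)"
        using r by (simp add: power2_eq_square flip: exp_add)
      moreover have "((2 * pi * r) powr (- 1 / 2))\<^sup>2 = 1 / (2 * (pi * r))"
        using r by (simp add: powr_minus powr_half_sqrt power_divide inverse_eq_divide)
      ultimately have "(heat_kernel r x)\<^sup>2 = 1 / (2 * (pi * r)) * exp (- x\<^sup>2 / r)"
        by (simp only: heat_kernel_def power_mult_distrib)
      also have "\<dots> = 1 / (2 * sqrt (pi * r)) * (1 / sqrt (pi * r) * exp (- x\<^sup>2 / r))"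
        using r by simp
      also have "1 / sqrt (pi * r) * exp (- x\<^sup>2 / r) = normal_density 0 (sqrt (r / 2)) x"
        using r by (simp add: normal_density_def)
      finally show ?thesis .
    qed
    interpret N: prob_space "density lborel (\<lambda>x. ennreal (normal_density 0 (sqrt (r / 2)) x))"
      using r by (intro prob_space_normal_density) simp
    have one: "(\<integral>\<^sup>+ x. ennreal (normal_density 0 (sqrt (r / 2)) x) \<partial>lborel) = 1"
      using N.emeasure_space_1 by (simp add: emeasure_density)
    have "(\<integral>\<^sup>+ x. ennreal ((heat_kernel r x)\<^sup>2) \<partial>lborel) = ennreal (1 / (2 * sqrt (pi * r)))"
      unfolding square using r by (subst ennreal_mult) (auto simp: nn_integral_cmult one)
    also have "\<dots> \<le> ennreal (r powr (-1/2))"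
    proof -
      have "sqrt r \<le> sqrt (pi * r)"
        using r pi_gt3 by (intro real_sqrt_le_mono) (simp add: mult_le_cancel_right1)
      also have "\<dots> \<le> 2 * sqrt (pi * r)"
        using r by simp
      finally have "sqrt r \<le> 2 * sqrt (pi * r)" .
      then have "1 / (2 * sqrt (pi * r)) \<le> 1 / sqrt r"
        using r by (intro divide_left_mono) auto
      then show ?thesis
        using r by (intro ennreal_leI) (simp add: powr_minus powr_half_sqrt inverse_eq_divide)
    qed
    finally show ?thesis .
  qed (simp add: heat_kernel_def)
  moreover have "(\<integral>\<^sup>+ r \<in> {0..T}. ennreal (r powr (-1/2)) \<partial>lborel) \<le> ennreal (2 * sqrt T)"
    using assms by (subst nn_integral_powr_Icc) (auto simp: powr_half_sqrt)
  moreover have "heat_kernel r \<in> borel_measurable borel" for r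
    unfolding heat_kernel_def by measurable
  ultimately show ?thesis
    unfolding kernel_energy_le_def by (auto intro!: bexI[where x = "\<lambda>r. ennreal (r powr (-1/2))"])
qed

lemma kernel_energy_le_mono:
  "kernel_energy_le G T K \<Longrightarrow> K \<le> K' \<Longrightarrow> kernel_energy_le G T K'"
  unfolding kernel_energy_le_def by (meson ennreal_leI order_trans)

section \<open>Comparison of the norms\<close>

lemma c_tilde_antimono:
  assumes "1/4 \<le> \<alpha>" "\<alpha> \<le> \<beta>"
  shows "c_tilde \<beta> \<le> c_tilde \<alpha>"
proof -
  have "0 \<le> (\<beta> - \<alpha>) * (2 * (\<alpha> + \<beta>) - 1)"
    using assms by (intro mult_nonneg_nonneg) auto
  then have "\<beta> * (1 - 2 * \<beta>) \<le> \<alpha> * (1 - 2 * \<alpha>)"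
    by (simp add: algebra_simps)
  then show ?thesis
    unfolding c_tilde_def by (rule divide_right_mono) simp
qed

text \<open>
  Near and far pairs are separated at each \<open>(t, x)\<close> and each time \<open>s\<close>. The far part is then at most
  a constant times the integral of the squared kernel over \<open>[0, t] \<times> \<real>\<close>, which reflection in time
  and translation in space reduce to the bound \<open>K\<close>.
\<close>

lemma chi2_seminorm_le:
  assumes p: "p \<ge> 2" and K: "K > 0" and G: "kernel_energy_le G T K"
    and \<alpha>\<beta>: "1/4 < \<alpha>" "\<alpha> \<le> \<beta>" "\<beta> < 1/2" and Y: "L2_continuous M T Y"
  shows "chi2_seminorm M G T p \<beta> Y \<le> ennreal (1 + 2 * sqrt K) * chi_norm M G T p \<alpha> Y"
proof (cases "chi1_norm M T p Y")
  case top
  then show ?thesis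
    using K by (simp add: chi_norm_def ennreal_mult_top add_nonneg_eq_0_iff)
next
  case (real N)
  have [measurable]: "\<And>r. G r \<in> borel_measurable borel"
    using G by (simp add: kernel_energy_le_def)
  obtain k where [measurable]: "k \<in> borel_measurable borel"
    and k: "\<And>r. r \<ge> 0 \<Longrightarrow> (\<integral>\<^sup>+ x. ennreal ((G r x)\<^sup>2) \<partial>lborel) \<le> k r"
    and kK: "(\<integral>\<^sup>+ r \<in> {0..T}. k r \<partial>lborel) \<le> ennreal K"
    using G unfolding kernel_energy_le_def by blast
  define D where "D s y z = ennreal_powr (abs_moment M p (\<lambda>\<omega>. Y s y \<omega> - Y s z \<omega>)) (2 / p)" for s y z
  define J where "J H t x s = (\<integral>\<^sup>+ (y, z). ennreal ((G (t - s) (x - y))\<^sup>2) * D s y z /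
      ennreal (\<bar>y - z\<bar> powr (2 - 2 * H)) \<partial>(lborel :: (real \<times> real) measure))" for H t x s
  define A where "A H t x = ennreal_powr (ennreal (c_tilde H) * (\<integral>\<^sup>+ s \<in> {0..t}. J H t x s \<partial>lborel)) (1/2)"
    for H t x
  have seminorm: "chi2_seminorm M G T p H Y = (SUP (t, x) \<in> {0..T} \<times> UNIV. A H t x)" for H
    by (simp add: chi2_seminorm_def A_def J_def D_def)
  have D: "D s y z \<le> ennreal (8 * N\<^sup>2)" if "s \<in> {0..T}" for s y z
  proof -
    have "ennreal_powr (abs_moment M p (Y s x)) (1 / p) \<le> ennreal N" for x
      unfolding real(2)[symmetric] chi1_norm_def using that by (intro SUP_upper2[where i = "(s, x)"]) auto
    then show ?thesis
      unfolding D_def using Y that p real(1)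
      by (intro increment_moment_le) (auto simp: L2_continuous_def)
  qed
  have c_bounds: "0 \<le> c_tilde \<beta>" "c_tilde \<beta> \<le> c_tilde \<alpha>"
    using \<alpha>\<beta> c_tilde_antimono[of \<alpha> \<beta>] by (auto simp: c_tilde_def)
  define b where "b = ennreal (2 * (8 * N\<^sup>2) / (1 - 2 * \<beta>))"
  have pointwise: "A \<beta> t x \<le> A \<alpha> t x + ennreal (2 * sqrt K * N)" if t: "t \<in> {0..T}" for t x
  proof -
    have Js: "J \<beta> t x s \<le> J \<alpha> t x s + b * k (t - s)" if s: "s \<in> {0..t}" for s
    proof -
      have "(\<integral>\<^sup>+ y. ennreal ((G (t - s) (x - y))\<^sup>2) \<partial>lborel) = (\<integral>\<^sup>+ y. ennreal ((G (t - s) y)\<^sup>2) \<partial>lborel)"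
        by (subst (2) nn_integral_real_affine[where c = "-1" and t = x]) auto
      also have "\<dots> \<le> k (t - s)"
        using s by (intro k) auto
      finally have "b * (\<integral>\<^sup>+ y. ennreal ((G (t - s) (x - y))\<^sup>2) \<partial>lborel) \<le> b * k (t - s)"
        by (rule mult_left_mono) simp
      moreover have "J \<beta> t x s \<le> J \<alpha> t x s + b * (\<integral>\<^sup>+ y. ennreal ((G (t - s) (x - y))\<^sup>2) \<partial>lborel)"
        unfolding J_def b_def using \<alpha>\<beta> s t by (intro gagliardo_integral_le D) auto
      ultimately show ?thesis
        by (meson add_left_mono order_trans)
    qed
    have energy: "(\<integral>\<^sup>+ s \<in> {0..t}. k (t - s) \<partial>lborel) \<le> ennreal K"
    proof -
      have "(\<integral>\<^sup>+ s \<in> {0..t}. k (t - s) \<partial>lborel) = (\<integral>\<^sup>+ r \<in> {0..t}. k r \<partial>lborel)"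
        by (subst (2) nn_integral_real_affine[where c = "-1" and t = t])
           (auto intro!: nn_integral_cong simp: indicator_def)
      also have "\<dots> \<le> (\<integral>\<^sup>+ r \<in> {0..T}. k r \<partial>lborel)"
        using t by (intro nn_integral_mono mult_left_mono indicator_leI) auto
      finally show ?thesis
        using kK by (rule order_trans)
    qed
    have "(\<integral>\<^sup>+ s \<in> {0..t}. J \<beta> t x s \<partial>lborel)
        \<le> (\<integral>\<^sup>+ s. J \<alpha> t x s * indicator {0..t} s + b * (k (t - s) * indicator {0..t} s) \<partial>lborel)"
      using Js by (intro nn_integral_mono) (auto simp: indicator_def)
    also have "\<dots> \<le> (\<integral>\<^sup>+ s \<in> {0..t}. J \<alpha> t x s \<partial>lborel) + (\<integral>\<^sup>+ s. b * (k (t - s) * indicator {0..t} s) \<partial>lborel)"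
      by (rule nn_integral_add_le) measurable
    also have "(\<integral>\<^sup>+ s. b * (k (t - s) * indicator {0..t} s) \<partial>lborel) = b * (\<integral>\<^sup>+ s \<in> {0..t}. k (t - s) \<partial>lborel)"
      by (subst nn_integral_cmult) auto
    also have "(\<integral>\<^sup>+ s \<in> {0..t}. J \<alpha> t x s \<partial>lborel) + b * (\<integral>\<^sup>+ s \<in> {0..t}. k (t - s) \<partial>lborel)
        \<le> (\<integral>\<^sup>+ s \<in> {0..t}. J \<alpha> t x s \<partial>lborel) + b * ennreal K"
      using energy by (intro add_left_mono mult_left_mono) auto
    finally have "ennreal (c_tilde \<beta>) * (\<integral>\<^sup>+ s \<in> {0..t}. J \<beta> t x s \<partial>lborel)
        \<le> ennreal (c_tilde \<beta>) * (\<integral>\<^sup>+ s \<in> {0..t}. J \<alpha> t x s \<partial>lborel) + ennreal (c_tilde \<beta>) * (b * ennreal K)"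
      by (metis distrib_left mult_left_mono zero_le)
    also have "\<dots> \<le> ennreal (c_tilde \<alpha>) * (\<integral>\<^sup>+ s \<in> {0..t}. J \<alpha> t x s \<partial>lborel) + ennreal (4 * K * N\<^sup>2)"
    proof (intro add_mono mult_right_mono ennreal_leI c_bounds)
      \<comment> \<open>The factor \<open>1 - 2 * \<beta>\<close> in \<open>c_tilde \<beta>\<close> cancels the one in \<open>b\<close>, which keeps the bound uniform
        as \<open>\<beta>\<close> tends to \<open>1/2\<close>.\<close>
      have "c_tilde \<beta> * (2 * (8 * N\<^sup>2) / (1 - 2 * \<beta>) * K) = 8 * \<beta> * (K * N\<^sup>2)"
        using \<alpha>\<beta> by (simp add: c_tilde_def)
      also have "\<dots> \<le> 4 * (K * N\<^sup>2)"
        using \<alpha>\<beta> K by (intro mult_right_mono) auto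
      finally show "ennreal (c_tilde \<beta>) * (b * ennreal K) \<le> ennreal (4 * K * N\<^sup>2)"
        unfolding b_def using c_bounds \<alpha>\<beta> K by (simp add: ennreal_leI flip: ennreal_mult)
    qed auto
    finally have "A \<beta> t x \<le> ennreal_powr
        (ennreal (c_tilde \<alpha>) * (\<integral>\<^sup>+ s \<in> {0..t}. J \<alpha> t x s \<partial>lborel) + ennreal (4 * K * N\<^sup>2)) (1/2)"
      unfolding A_def by (intro ennreal_powr_mono) auto
    also have "\<dots> \<le> A \<alpha> t x + ennreal_powr (ennreal (4 * K * N\<^sup>2)) (1/2)"
      unfolding A_def by (rule ennreal_powr_half_add_le)
    also have "ennreal_powr (ennreal (4 * K * N\<^sup>2)) (1/2) = ennreal (2 * sqrt K * N)"
      using K real(1) by (simp add: ennreal_powr_ennreal powr_half_sqrt real_sqrt_mult)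
    finally show ?thesis .
  qed
  have "A \<beta> t x \<le> chi2_seminorm M G T p \<alpha> Y + ennreal (2 * sqrt K * N)" if t: "t \<in> {0..T}" for t x
  proof -
    have "A \<alpha> t x \<le> chi2_seminorm M G T p \<alpha> Y"
      unfolding seminorm using t by (intro SUP_upper2[where i = "(t, x)"]) auto
    with pointwise[OF t] show ?thesis
      by (meson add_right_mono order_trans)
  qed
  then have "chi2_seminorm M G T p \<beta> Y \<le> chi2_seminorm M G T p \<alpha> Y + ennreal (2 * sqrt K * N)"
    unfolding seminorm[of \<beta>] by (intro SUP_least) auto
  also have "\<dots> = chi2_seminorm M G T p \<alpha> Y + ennreal (2 * sqrt K) * chi1_norm M T p Y"
    using K real by (simp add: ennreal_mult)
  also have "\<dots> \<le> ennreal (1 + 2 * sqrt K) * chi2_seminorm M G T p \<alpha> Y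
      + ennreal (1 + 2 * sqrt K) * chi1_norm M T p Y"
  proof (intro add_mono)
    have "ennreal 1 * chi2_seminorm M G T p \<alpha> Y \<le> ennreal (1 + 2 * sqrt K) * chi2_seminorm M G T p \<alpha> Y"
      using K by (intro mult_right_mono ennreal_leI) auto
    then show "chi2_seminorm M G T p \<alpha> Y \<le> ennreal (1 + 2 * sqrt K) * chi2_seminorm M G T p \<alpha> Y"
      by simp
  qed (auto intro!: mult_right_mono ennreal_leI)
  finally show ?thesis
    by (simp add: chi_norm_def distrib_left add.commute)
qed

theorem lemma2p17:
  fixes T p :: real
  assumes "T > 0" and "p \<ge> 2"
  shows
    "(\<forall>(M :: 'a measure) F. \<forall>G \<in> {wave_kernel, heat_kernel}. \<forall>\<alpha> \<beta> :: real.
        complete_filtered_prob_space M T F \<longrightarrow> 1/4 < \<alpha> \<longrightarrow> \<alpha> \<le> \<beta> \<longrightarrow> \<beta> < 1/2 \<longrightarrow>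
        chi_space M F G T p \<alpha> \<subseteq> chi_space M F G T p \<beta> \<and>
        (\<exists>C :: real. C > 0 \<and>
          (\<forall>Y. regular_process M F T Y \<longrightarrow>
             chi_norm M G T p \<beta> Y \<le> ennreal C * chi_norm M G T p \<alpha> Y)))
     \<and>
     (\<exists>C :: real. C > 0 \<and>
        (\<forall>(M :: 'a measure) F. \<forall>G \<in> {wave_kernel, heat_kernel}. \<forall>\<alpha> :: real. \<forall>Y.
           complete_filtered_prob_space M T F \<longrightarrow> 1/4 < \<alpha> \<longrightarrow> \<alpha> < 1/2 \<longrightarrow>
           regular_process M F T Y \<longrightarrow>
           (SUP \<beta> \<in> {\<alpha>..<1/2}. chi2_seminorm M G T p \<beta> Y)
             \<le> ennreal C * chi_norm M G T p \<alpha> Y))"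
proof -
  define K where "K = T\<^sup>2 + 2 * sqrt T"
  define C where "C = 1 + 2 * sqrt K"
  have K: "K > 0"
    using assms by (simp add: K_def add_pos_pos)
  then have C: "C > 0"
    by (simp add: C_def add_pos_nonneg)
  have energy: "kernel_energy_le G T K" if "G \<in> {wave_kernel, heat_kernel}" for G
    using that assms wave_kernel_energy_le[of T] heat_kernel_energy_le[of T]
    by (auto simp: K_def elim!: kernel_energy_le_mono)
  have seminorm: "chi2_seminorm M G T p \<beta> Y \<le> ennreal C * chi_norm M G T p \<alpha> Y"
    if "G \<in> {wave_kernel, heat_kernel}" "1/4 < \<alpha>" "\<alpha> \<le> \<beta>" "\<beta> < 1/2" "regular_process M F T Y"
    for M :: "'a measure" and F G \<alpha> \<beta> Y
    unfolding C_def using that assms K energy[OF that(1)]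
    by (intro chi2_seminorm_le) (auto simp: regular_process_def)
  have norm: "chi_norm M G T p \<beta> Y \<le> ennreal (1 + C) * chi_norm M G T p \<alpha> Y"
    if "G \<in> {wave_kernel, heat_kernel}" "1/4 < \<alpha>" "\<alpha> \<le> \<beta>" "\<beta> < 1/2" "regular_process M F T Y"
    for M :: "'a measure" and F G \<alpha> \<beta> Y
  proof -
    have "chi_norm M G T p \<beta> Y \<le> chi_norm M G T p \<alpha> Y + ennreal C * chi_norm M G T p \<alpha> Y"
      unfolding chi_norm_def[of M G T p \<beta>] using seminorm[OF that]
      by (intro add_mono) (auto simp: chi_norm_def)
    also have "\<dots> = ennreal (1 + C) * chi_norm M G T p \<alpha> Y"
      using C by (simp add: distrib_right)
    finally show ?thesis .
  qed
  have inclusion: "chi_space M F G T p \<alpha> \<subseteq> chi_space M F G T p \<beta>"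
    if "G \<in> {wave_kernel, heat_kernel}" "1/4 < \<alpha>" "\<alpha> \<le> \<beta>" "\<beta> < 1/2"
    for M :: "'a measure" and F G \<alpha> \<beta>
  proof
    fix Y assume "Y \<in> chi_space M F G T p \<alpha>"
    then have Y: "regular_process M F T Y" and "ennreal (1 + C) * chi_norm M G T p \<alpha> Y < \<infinity>"
      by (simp_all add: chi_space_def ennreal_mult_less_top)
    then show "Y \<in> chi_space M F G T p \<beta>"
      using norm[OF that Y] by (simp add: chi_space_def le_less_trans)
  qed
  show ?thesis
  proof (intro conjI allI ballI impI)
    show "\<exists>C>0. \<forall>Y. regular_process M F T Y \<longrightarrow> chi_norm M G T p \<beta> Y \<le> ennreal C * chi_norm M G T p \<alpha> Y"
      if "G \<in> {wave_kernel, heat_kernel}" "1/4 < \<alpha>" "\<alpha> \<le> \<beta>" "\<beta> < 1/2"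
      for M :: "'a measure" and F G \<alpha> \<beta>
      using norm[OF that] C by (intro exI[of _ "1 + C"]) auto
    show "\<exists>C>0. \<forall>(M :: 'a measure) F. \<forall>G \<in> {wave_kernel, heat_kernel}. \<forall>\<alpha> :: real. \<forall>Y.
           complete_filtered_prob_space M T F \<longrightarrow> 1/4 < \<alpha> \<longrightarrow> \<alpha> < 1/2 \<longrightarrow>
           regular_process M F T Y \<longrightarrow>
           (SUP \<beta> \<in> {\<alpha>..<1/2}. chi2_seminorm M G T p \<beta> Y) \<le> ennreal C * chi_norm M G T p \<alpha> Y"
      using C by (intro exI[of _ C] conjI allI ballI impI SUP_least seminorm) auto
  qed (rule inclusion)
qed

end
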